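(* Let $d\ge 1$, let $A$ be a finite alphabet, let $F:A^{\mathbb{Z}^d}\to A^{\mathbb{Z}^d}$ be a surjective cellular automaton, and let $\mu$ be the uniform Bernoulli measure on $A^{\mathbb{Z}^d}$. If $F$ is equicontinuous, then all measurable eigenvalues of $F$ are rational.
   Context: A cellular automaton is a map $F:A^{\mathbb{Z}^d}\to A^{\mathbb{Z}^d}$ of the form $F(x)_{m}=f(x_{m+K})$ for all $m\in\mathbb{Z}^d$, with $K\subset\mathbb{Z}^d$ finite and $f:A^{K}\to A$. The metric on $A^{\mathbb{Z}^d}$ is $\mathrm{dist}(x,y)=2^{-\min\{\|i\|:x_i\ne y_i\}}$ for $x\ne y$, with $\|i\|=\max_s|i_s|$, and $\mathrm{dist}(x,x)=0$. A point $x$ is an equicontinuity point of $F$ if for every $\varepsilon>0$ there is $\delta>0$ such that for all $y$ with $\mathrm{dist}(x,y)<\delta$ and all $n\in\mathbb{N}$, $\mathrm{dist}(F^n(x),F^n(y))<\varepsilon$; $F$ is equicontinuous if every point is an equicontinuity point. The uniform Bernoulli measure $\mu$ is the product of the uniform probability measures on $A$; it is $F$-invariant when $F$ is surjective. A complex number $\lambda=e^{2\pi i\alpha}$, $\alpha\in\mathbb{R}$, is a measurable eigenvalue of $F$ if there is a measurable $g:A^{\mathbb{Z}^d}\to\mathbb{C}$, not $\mu$-almost everywhere zero, with $g\circ F=\lambda g$ $\mu$-almost everywhere; it is rational (irrational) if $\alpha$ is rational (irrational). *)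

theory Defs
  imports "HOL-Probability.Probability"
begin

text \<open>
  The lattice of dimension \<open>d \<ge> 1\<close> is \<^typ>\<open>int ^ 'd\<close> with \<open>d = CARD('d)\<close>, and the
  alphabet is a type of class \<^class>\<open>finite\<close>, hence nonempty.
\<close>

type_synonym ('a, 'd) config = "int ^ 'd \<Rightarrow> 'a"

text \<open>Two local rules agreeing on the extensional functions \<open>K \<rightarrow>\<^sub>E UNIV\<close>, which represent
  the patterns of shape \<open>K\<close>, define the same map: a rule is only applied to restrictions to \<open>K\<close>.\<close>

definition cellular_automaton :: "(('a, 'd::finite) config \<Rightarrow> ('a, 'd) config) \<Rightarrow> bool" where
  "cellular_automaton F \<longleftrightarrow>
     (\<exists>(K :: (int ^ 'd) set) (f :: ('a, 'd) config \<Rightarrow> 'a).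
        finite K \<and> (\<forall>x m. F x m = f (restrict (\<lambda>k. x (m + k)) K)))"

definition lattice_norm :: "int ^ 'd::finite \<Rightarrow> nat" where
  "lattice_norm i = nat (Max (range (\<lambda>s. \<bar>i $ s\<bar>)))"

definition config_dist :: "('a, 'd::finite) config \<Rightarrow> ('a, 'd) config \<Rightarrow> real" where
  "config_dist x y =
     (if x = y then 0 else 1 / 2 ^ (LEAST n. \<exists>i. x i \<noteq> y i \<and> n = lattice_norm i))"

definition equicontinuity_point ::
    "(('a, 'd::finite) config \<Rightarrow> ('a, 'd) config) \<Rightarrow> ('a, 'd) config \<Rightarrow> bool" where
  "equicontinuity_point F x \<longleftrightarrow>
     (\<forall>\<epsilon>>0. \<exists>\<delta>>0. \<forall>y. config_dist x y < \<delta> \<longrightarrow>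
        (\<forall>n. config_dist ((F ^^ n) x) ((F ^^ n) y) < \<epsilon>))"

definition equicontinuous :: "(('a, 'd::finite) config \<Rightarrow> ('a, 'd) config) \<Rightarrow> bool" where
  "equicontinuous F \<longleftrightarrow> (\<forall>x. equicontinuity_point F x)"

definition uniform_bernoulli :: "('a::finite, 'd::finite) config measure" where
  "uniform_bernoulli = (\<Pi>\<^sub>M i\<in>UNIV. uniform_count_measure UNIV)"

definition measurable_eigenvalue ::
    "(('a::finite, 'd::finite) config \<Rightarrow> ('a, 'd) config) \<Rightarrow> complex \<Rightarrow> bool" where
  "measurable_eigenvalue F l \<longleftrightarrow>
     (\<exists>\<alpha>::real. l = exp (2 * of_real pi * \<i> * of_real \<alpha>)) \<and>
     (\<exists>g \<in> borel_measurable uniform_bernoulli.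
        \<not> (AE x in uniform_bernoulli. g x = 0) \<and>
        (AE x in uniform_bernoulli. g (F x) = l * g x))"

end

theory Submission
  imports Defs
begin

text \<open>
  The proof rests on two facts about a surjective equicontinuous cellular automaton \<open>F\<close>.

  First, \<open>F\<close> is periodic: \<open>F\<^sup>p = id\<close> for some \<open>p > 0\<close>.  By compactness of the configuration space,
  equicontinuity is uniform, so a single finite cube determines the symbols \<open>(F\<^sup>n x) 0\<close> for all \<open>n\<close>
  at once (\<open>equicontinuous_uniform_window\<close>).  All iterates of \<open>F\<close> therefore have local rules on
  that cube; only finitely many such rules exist, so two iterates coincide, and surjectivity cancels the
  smaller of the two (\<open>surj_equicontinuous_imp_periodic\<close>).

  Second, \<open>F\<close> preserves the uniform Bernoulli measure (\<open>inj_cellular_automaton_preserves_bernoulli\<close>).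
  This holds for every surjective cellular automaton, but periodicity makes \<open>F\<close> injective and permits a short
  argument: an event that depends only on a cube of side \<open>2 M + 1\<close> has measure proportional to
  the number of spatially periodic configurations of period \<open>2 M + 1\<close> in it, and \<open>F\<close> permutes this finite set.

  Consequently the relation \<open>g \<circ> F = \<lambda> g\<close> a.e. can be iterated, because preimages of null sets
  are null, which gives \<open>g = g \<circ> F\<^sup>p = \<lambda>\<^sup>p g\<close> a.e.; since \<open>g\<close> is not a.e. zero, \<open>\<lambda>\<^sup>p = 1\<close>.
\<close>

section \<open>Cubes and the configuration metric\<close>

definition cube :: "nat \<Rightarrow> (int ^ 'd::finite) set" where
  "cube M = {i. \<forall>s. \<bar>i $ s\<bar> \<le> int M}"

lemma lattice_norm_le_iff: "lattice_norm i \<le> M \<longleftrightarrow> i \<in> cube M"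
proof -
  have "lattice_norm i \<le> M \<longleftrightarrow> Max (range (\<lambda>s. \<bar>i $ s\<bar>)) \<le> int M"
    unfolding lattice_norm_def by linarith
  also have "\<dots> \<longleftrightarrow> i \<in> cube M"
    by (auto simp: cube_def)
  finally show ?thesis .
qed

lemma lattice_norm_0 [simp]: "lattice_norm 0 = 0"
  using lattice_norm_le_iff[of 0 0] by (simp add: cube_def)

lemma cube_mono: "M \<le> N \<Longrightarrow> cube M \<subseteq> cube N"
  by (metis lattice_norm_le_iff order_trans subsetI)

lemma finite_cube: "finite (cube M :: (int ^ 'd::finite) set)"
proof (rule finite_subset)
  show "cube M \<subseteq> vec_lambda ` (UNIV \<rightarrow>\<^sub>E {- int M..int M} :: ('d \<Rightarrow> int) set)"
  proof
    fix i :: "int ^ 'd" assume "i \<in> cube M"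
    then have "vec_nth i \<in> UNIV \<rightarrow>\<^sub>E {- int M..int M}"
      by (auto simp: cube_def abs_le_iff minus_le_iff)
    then show "i \<in> vec_lambda ` (UNIV \<rightarrow>\<^sub>E {- int M..int M})"
      by (rule rev_image_eqI) simp
  qed
qed (intro finite_imageI finite_PiE; simp)

lemma finite_subset_cube:
  assumes "finite (J :: (int ^ 'd::finite) set)"
  obtains M where "J \<subseteq> cube M"
proof
  show "J \<subseteq> cube (Max (insert 0 (lattice_norm ` J)))"
    using assms by (auto simp flip: lattice_norm_le_iff)
qed

lemma config_dist_less_1_imp_eq_0:
  assumes "config_dist x y < 1"
  shows "x 0 = y 0"
proof (rule ccontr)
  assume "x 0 \<noteq> y 0"
  then have "(LEAST n. \<exists>i. x i \<noteq> y i \<and> n = lattice_norm i) = 0"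
    by (intro Least_eq_0 exI[of _ 0]) simp
  moreover have "x \<noteq> y" using \<open>x 0 \<noteq> y 0\<close> by auto
  ultimately show False
    using assms by (simp add: config_dist_def)
qed

lemma config_dist_le_if_eq_on_cube:
  assumes "\<And>i. i \<in> cube M \<Longrightarrow> x i = y i"
  shows "config_dist x y \<le> 1 / 2 ^ M"
proof (cases "x = y")
  case False
  then have "\<exists>n. \<exists>i. x i \<noteq> y i \<and> n = lattice_norm i" by auto
  from LeastI_ex[OF this] obtain i where i: "x i \<noteq> y i"
    "(LEAST n. \<exists>i. x i \<noteq> y i \<and> n = lattice_norm i) = lattice_norm i" by auto
  have "M \<le> lattice_norm i"
    using assms i(1) lattice_norm_le_iff by (metis nat_le_linear)
  with False i(2) show ?thesis
    by (simp add: config_dist_def field_simps power_increasing)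
qed (simp add: config_dist_def)

section \<open>Locality and shift invariance\<close>

lemma cellular_automaton_shift:
  assumes "cellular_automaton F"
  shows "F (\<lambda>i. x (i + t)) m = F x (m + t)"
  using assms unfolding cellular_automaton_def by (auto simp: ac_simps)

lemma cellular_automaton_funpow_shift:
  assumes "cellular_automaton F"
  shows "(F ^^ n) (\<lambda>i. x (i + t)) = (\<lambda>i. (F ^^ n) x (i + t))"
proof (induction n)
  case (Suc n)
  then show ?case
    using cellular_automaton_shift[OF assms, of "(F ^^ n) x" t] by auto
qed simp

lemma cellular_automaton_local:
  assumes "cellular_automaton F"
  obtains K where "finite K"
    "\<And>x y m. (\<And>k. k \<in> K \<Longrightarrow> x (m + k) = y (m + k)) \<Longrightarrow> F x m = F y m"
proof -
  from assms obtain K f where K: "finite K"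
    "\<And>x m. F x m = f (restrict (\<lambda>k. x (m + k)) K)"
    unfolding cellular_automaton_def by blast
  have "F x m = F y m" if "\<And>k. k \<in> K \<Longrightarrow> x (m + k) = y (m + k)" for x y m
    unfolding K(2) using that by (metis (mono_tags, lifting) restrict_ext)
  with K(1) that show ?thesis by blast
qed

section \<open>Surjective equicontinuous cellular automata are periodic\<close>

text \<open>At each point, equicontinuity with \<open>\<epsilon> = 1\<close> gives a finite window around the origin on which agreement forces
  all iterates to agree at the origin.  The corresponding cylinders are open in the product
  topology, which is compact by Tychonoff's theorem, so finitely many of them suffice.\<close>

lemma equicontinuous_uniform_window:
  fixes F :: "('a::finite, 'd::finite) config \<Rightarrow> ('a, 'd) config"
  assumes "equicontinuous F"
  obtains M where
    "\<And>n x y. (\<And>i. i \<in> cube M \<Longrightarrow> x i = y i) \<Longrightarrow> (F ^^ n) x 0 = (F ^^ n) y 0"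
proof -
  have "\<exists>N. \<forall>y. (\<forall>i\<in>cube N. x i = y i) \<longrightarrow> (\<forall>n. (F ^^ n) x 0 = (F ^^ n) y 0)" for x
  proof -
    obtain \<delta> where "\<delta> > 0"
      and \<delta>: "\<And>y n. config_dist x y < \<delta> \<Longrightarrow> config_dist ((F ^^ n) x) ((F ^^ n) y) < 1"
      using assms unfolding equicontinuous_def equicontinuity_point_def
      by (metis zero_less_one)
    obtain N where "(1 / 2) ^ N < \<delta>"
      using real_arch_pow_inv[of \<delta> "1/2"] \<open>\<delta> > 0\<close> by auto
    then have "config_dist x y < \<delta>" if "\<forall>i\<in>cube N. x i = y i" for y
      using config_dist_le_if_eq_on_cube[of N x y] that by (simp add: power_one_over)
    with \<delta> show ?thesis
      by (intro exI[of _ N]) (blast intro: config_dist_less_1_imp_eq_0)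
  qed
  then obtain N where N: "\<And>x y n. (\<forall>i\<in>cube (N x). x i = y i) \<Longrightarrow> (F ^^ n) x 0 = (F ^^ n) y 0"
    by metis
  define U where "U x = {y. \<forall>i\<in>cube (N x). x i = y i}" for x
  let ?T = "product_topology (\<lambda>_ :: int ^ 'd. discrete_topology (UNIV :: 'a set)) UNIV"
  have "openin ?T (U x)" for x
  proof -
    have "U x = PiE UNIV (\<lambda>i. if i \<in> cube (N x) then {x i} else UNIV)"
      unfolding U_def set_eq_iff mem_Collect_eq PiE_UNIV_domain Pi_iff
      by (metis UNIV_I singleton_iff)
    moreover have "finite {i. (if i \<in> cube (N x) then {x i} else UNIV) \<noteq> UNIV}"
      by (rule finite_subset[OF _ finite_cube[of "N x"]]) auto
    ultimately show ?thesis
      by (simp add: openin_PiE_gen)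
  qed
  moreover have "compact_space ?T"
    by (simp add: compact_space_product_topology compact_space_discrete_topology)
  moreover have "topspace ?T \<subseteq> \<Union>(range U)"
    by (auto simp: U_def)
  ultimately obtain \<F> where "finite \<F>" "\<F> \<subseteq> range U" "topspace ?T \<subseteq> \<Union>\<F>"
    unfolding compact_space_def compactin_def by (metis (no_types, lifting) imageE)
  then obtain X where X: "finite X" "UNIV \<subseteq> \<Union>(U ` X)"
    using finite_subset_image[of \<F> U UNIV] by auto
  define M where "M = Max (insert 0 (N ` X))"
  show ?thesis
  proof
    fix n and x y :: "('a, 'd) config" assume xy: "\<And>i. i \<in> cube M \<Longrightarrow> x i = y i"
    obtain z where z: "z \<in> X" "x \<in> U z" using X by blast
    then have "N z \<le> M" unfolding M_def using X by auto
    then have "y \<in> U z"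
      using z xy cube_mono[of "N z" M] by (auto simp: U_def)
    with z(2) have "(F ^^ n) z 0 = (F ^^ n) x 0" "(F ^^ n) z 0 = (F ^^ n) y 0"
      unfolding U_def using N by blast+
    then show "(F ^^ n) x 0 = (F ^^ n) y 0" by simp
  qed
qed

text \<open>By shift invariance, \<open>F\<^sup>n\<close> is determined by the symbol it writes at the origin, hence by a map from patterns on one fixed
  cube to symbols.  By the pigeonhole principle two exponents \<open>a < b\<close> give the same map.\<close>

lemma surj_equicontinuous_imp_periodic:
  fixes F :: "('a::finite, 'd::finite) config \<Rightarrow> ('a, 'd) config"
  assumes ca: "cellular_automaton F" and "surj F" and "equicontinuous F"
  obtains p where "p > 0" "F ^^ p = id"
proof -
  obtain M where M:
    "\<And>n x y. (\<And>i. i \<in> cube M \<Longrightarrow> x i = y i) \<Longrightarrow> (F ^^ n) x 0 = (F ^^ n) y 0"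
    using equicontinuous_uniform_window[OF assms(3)] by blast
  let ?P = "cube M \<rightarrow>\<^sub>E UNIV :: ('a, 'd) config set"
  define rule_of where "rule_of n = restrict (\<lambda>u. (F ^^ n) u 0) ?P" for n
  have rule: "(F ^^ n) x m = rule_of n (restrict (\<lambda>i. x (i + m)) (cube M))" for n x m
  proof -
    have "(F ^^ n) x m = (F ^^ n) (\<lambda>i. x (i + m)) 0"
      by (simp add: cellular_automaton_funpow_shift[OF ca])
    also have "\<dots> = (F ^^ n) (restrict (\<lambda>i. x (i + m)) (cube M)) 0"
      by (rule M) simp
    finally show ?thesis by (simp add: rule_of_def)
  qed
  have "range rule_of \<subseteq> ?P \<rightarrow>\<^sub>E UNIV"
    by (simp add: image_subset_iff rule_of_def)
  moreover have "finite (?P \<rightarrow>\<^sub>E (UNIV :: 'a set))"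
    by (intro finite_PiE finite_cube) auto
  ultimately have "\<not> inj rule_of"
    by (meson finite_imageD finite_subset infinite_UNIV_nat)
  then obtain a b where ab: "a < b" "rule_of a = rule_of b"
    unfolding inj_def by (metis linorder_neqE_nat)
  then have eq: "F ^^ a = F ^^ b"
    by (intro ext) (simp add: rule)
  \<comment> \<open>Every point lies in the image of \<open>F ^^ a\<close>, on which \<open>F ^^ (b - a)\<close> acts trivially.\<close>
  have "(F ^^ (b - a)) x = x" for x
  proof -
    obtain z where z: "x = (F ^^ a) z"
      using surj_fn[OF assms(2)] by (metis surjD)
    have "(F ^^ (b - a)) x = (F ^^ (b - a + a)) z"
      by (simp add: z funpow_add del: le_add_diff_inverse2)
    also have "\<dots> = x" using ab(1) eq z by simp
    finally show ?thesis .
  qed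
  then have "F ^^ (b - a) = id" by auto
  with ab(1) that[of "b - a"] show ?thesis by simp
qed

section \<open>Invariance of the uniform Bernoulli measure\<close>

definition periodic_configs :: "nat \<Rightarrow> ('a, 'd::finite) config set" where
  "periodic_configs M = {x. \<forall>i t. x (i + (\<chi> s. (2 * int M + 1) * t $ s)) = x i}"

text \<open>The representative in \<open>cube M\<close> of a residue class modulo \<open>2 M + 1\<close>.\<close>

definition wrap :: "nat \<Rightarrow> int ^ 'd::finite \<Rightarrow> int ^ 'd" where
  "wrap M i = (\<chi> s. (i $ s + int M) mod (2 * int M + 1) - int M)"

lemma wrap_in_cube: "wrap M i \<in> cube M"
proof -
  have "\<bar>(k + int M) mod (2 * int M + 1) - int M\<bar> \<le> int M" for k
    using pos_mod_bound[of "2 * int M + 1" "k + int M"]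
      pos_mod_sign[of "2 * int M + 1" "k + int M"] by linarith
  then show ?thesis by (simp add: cube_def wrap_def)
qed

lemma wrap_ident: "i \<in> cube M \<Longrightarrow> wrap M i = i"
proof -
  assume i: "i \<in> cube M"
  have "(i $ s + int M) mod (2 * int M + 1) = i $ s + int M" for s
  proof (rule mod_pos_pos_trivial)
    have "\<bar>i $ s\<bar> \<le> int M" using i by (simp add: cube_def)
    then show "0 \<le> i $ s + int M" "i $ s + int M < 2 * int M + 1" by linarith+
  qed
  then show ?thesis by (simp add: wrap_def vec_eq_iff)
qed

lemma wrap_add_period: "wrap M (i + (\<chi> s. (2 * int M + 1) * t $ s)) = wrap M i"
proof -
  have "(i $ s + (2 * int M + 1) * t $ s + int M) mod (2 * int M + 1) =
      (i $ s + int M) mod (2 * int M + 1)" for s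
    by (metis (no_types, opaque_lifting) add.assoc add.commute mod_mult_self2)
  then show ?thesis by (simp add: wrap_def vec_eq_iff)
qed

lemma comp_wrap_periodic: "x \<circ> wrap M \<in> periodic_configs M"
  by (simp add: periodic_configs_def wrap_add_period)

lemma periodic_configs_wrap:
  fixes x :: "('a, 'd::finite) config"
  assumes "x \<in> periodic_configs M"
  shows "x (wrap M i) = x i"
proof -
  define t :: "int ^ 'd" where "t = (\<chi> s. (i $ s + int M) div (2 * int M + 1))"
  have "i = wrap M i + (\<chi> s. (2 * int M + 1) * t $ s)"
  proof -
    have "i $ s = (i $ s + int M) mod (2 * int M + 1) - int M +
        (2 * int M + 1) * ((i $ s + int M) div (2 * int M + 1))" for s
      using mod_mult_div_eq[of "i $ s + int M" "2 * int M + 1"] by linarith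
    then show ?thesis
      unfolding vec_eq_iff wrap_def t_def vec_lambda_beta vector_add_component by blast
  qed
  then have "x i = x (wrap M i + (\<chi> s. (2 * int M + 1) * t $ s))"
    by (rule arg_cong)
  also have "\<dots> = x (wrap M i)"
    using assms unfolding periodic_configs_def by blast
  finally show ?thesis by simp
qed

lemma periodic_configs_eqI:
  assumes "x \<in> periodic_configs M" "y \<in> periodic_configs M" "\<And>i. i \<in> cube M \<Longrightarrow> x i = y i"
  shows "x = y"
proof
  fix i
  show "x i = y i"
    using assms(3)[OF wrap_in_cube[of M i]] assms(1,2) by (simp add: periodic_configs_wrap)
qed

lemma finite_periodic_configs: "finite (periodic_configs M :: ('a::finite, 'd::finite) config set)"
proof (rule inj_on_finite)
  show "inj_on (\<lambda>x. restrict x (cube M)) (periodic_configs M :: ('a, 'd) config set)"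
    by (rule inj_onI, erule (1) periodic_configs_eqI) (metis restrict_apply')
  show "(\<lambda>x. restrict x (cube M)) ` periodic_configs M \<subseteq> cube M \<rightarrow>\<^sub>E (UNIV :: 'a set)" by auto
  show "finite (cube M \<rightarrow>\<^sub>E (UNIV :: 'a set) :: ('a, 'd) config set)"
    by (intro finite_PiE finite_cube) auto
qed

text \<open>Injectivity on a finite invariant set is bijectivity, and the set of spatially periodic configurations is
  invariant because cellular automata commute with shifts.\<close>

lemma inj_cellular_automaton_permutes_periodic_configs:
  fixes F :: "('a::finite, 'd::finite) config \<Rightarrow> ('a, 'd) config"
  assumes ca: "cellular_automaton F" and "inj F"
  shows "bij_betw F (periodic_configs M) (periodic_configs M)"
proof -
  have sub: "F ` periodic_configs M \<subseteq> periodic_configs M"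
  proof (clarsimp simp: periodic_configs_def)
    fix x :: "('a, 'd) config" and i t
    assume "\<forall>i t. x (i + (\<chi> s. (2 * int M + 1) * t $ s)) = x i"
    then show "F x (i + (\<chi> s. (2 * int M + 1) * t $ s)) = F x i"
      by (simp flip: cellular_automaton_shift[OF ca])
  qed
  have inj: "inj_on F (periodic_configs M)"
    using assms(2) by (rule inj_on_subset) simp
  show ?thesis
    using endo_inj_surj[OF finite_periodic_configs sub inj] inj by (simp add: bij_betw_def)
qed

definition determined_by :: "(int ^ 'd::finite) set \<Rightarrow> ('a, 'd) config set \<Rightarrow> bool" where
  "determined_by J C \<longleftrightarrow> (\<forall>x y. (\<forall>i\<in>J. x i = y i) \<longrightarrow> (x \<in> C \<longleftrightarrow> y \<in> C))"

lemma determined_by_mono: "determined_by J C \<Longrightarrow> J \<subseteq> J' \<Longrightarrow> determined_by J' C"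
  unfolding determined_by_def by blast

lemma determined_by_vimage_cellular_automaton:
  fixes F :: "('a, 'd::finite) config \<Rightarrow> ('a, 'd) config"
  assumes "cellular_automaton F" "finite J" "determined_by J C"
  obtains J' where "finite J'" "determined_by J' (F -` C)"
proof -
  obtain K where K: "finite K"
    "\<And>x y m. (\<And>k. k \<in> K \<Longrightarrow> x (m + k) = y (m + k)) \<Longrightarrow> F x m = F y m"
    using cellular_automaton_local[OF assms(1)] by blast
  let ?J = "(\<lambda>(j, k). j + k) ` (J \<times> K)"
  show ?thesis
  proof
    show "finite ?J" using K(1) assms(2) by simp
    show "determined_by ?J (F -` C)"
      unfolding determined_by_def
    proof (intro allI impI)
      fix x y :: "('a, 'd) config" assume xy: "\<forall>i\<in>?J. x i = y i"
      have "F x m = F y m" if "m \<in> J" for m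
        by (rule K(2)) (use xy that in force)
      then show "x \<in> F -` C \<longleftrightarrow> y \<in> F -` C"
        using assms(3) unfolding determined_by_def vimage_eq by blast
    qed
  qed
qed

lemma prob_space_uniform_alphabet: "prob_space (uniform_count_measure (UNIV :: 'a::finite set))"
  by (rule prob_space_uniform_count_measure) auto

lemma space_uniform_bernoulli [simp]: "space uniform_bernoulli = UNIV"
  by (simp add: uniform_bernoulli_def space_PiM space_uniform_count_measure)

lemma prob_space_uniform_bernoulli:
  "prob_space (uniform_bernoulli :: ('a::finite, 'd::finite) config measure)"
  unfolding uniform_bernoulli_def by (intro prob_space_PiM prob_space_uniform_alphabet)

lemma
  fixes y :: "('a::finite, 'd::finite) config"
  assumes "finite J"
  shows cylinder_in_sets: "{x. \<forall>i\<in>J. x i = y i} \<in> sets uniform_bernoulli"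
    and emeasure_cylinder:
      "emeasure uniform_bernoulli {x. \<forall>i\<in>J. x i = y i} = ennreal (1 / CARD('a)) ^ card J"
proof -
  let ?M = "\<lambda>_ :: int ^ 'd. uniform_count_measure (UNIV :: 'a set)"
  have eq: "{x. \<forall>i\<in>J. x i = y i} = prod_emb UNIV ?M J (PiE J (\<lambda>i. {y i}))"
    by (auto simp: prod_emb_def space_uniform_count_measure PiE_iff)
  show "{x. \<forall>i\<in>J. x i = y i} \<in> sets uniform_bernoulli"
    unfolding eq uniform_bernoulli_def
    by (rule sets_PiM_I) (use assms in \<open>auto simp: sets_uniform_count_measure\<close>)
  show "emeasure uniform_bernoulli {x. \<forall>i\<in>J. x i = y i} = ennreal (1 / CARD('a)) ^ card J"
    unfolding eq uniform_bernoulli_def using assms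
    by (subst emeasure_PiM_emb)
      (auto simp: sets_uniform_count_measure emeasure_uniform_count_measure
            intro!: prob_space_uniform_alphabet)
qed

text \<open>Each periodic configuration of period \<open>2 M + 1\<close> is the periodic extension of exactly one pattern on \<open>cube M\<close>, so an event
  seen through \<open>cube M\<close> is the disjoint union of the cylinders around its periodic members.\<close>

lemma
  fixes C :: "('a::finite, 'd::finite) config set"
  assumes C: "determined_by (cube M) C"
  shows determined_by_cube_in_sets: "C \<in> sets uniform_bernoulli"
    and emeasure_determined_by_cube:
      "emeasure uniform_bernoulli C =
         of_nat (card (C \<inter> periodic_configs M)) *
         ennreal (1 / CARD('a)) ^ card (cube M :: (int ^ 'd) set)"
proof -
  define Z where "Z y = {x. \<forall>i\<in>cube M. x i = y i}" for y :: "('a, 'd) config"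
  let ?S = "C \<inter> periodic_configs M"
  have fin: "finite ?S" using finite_periodic_configs by blast
  have eq: "C = (\<Union>y\<in>?S. Z y)"
  proof (intro equalityI subsetI)
    fix x assume "x \<in> C"
    \<comment> \<open>The periodic extension of \<open>x\<close> restricted to the cube is the centre of the cylinder containing \<open>x\<close>.\<close>
    have *: "\<forall>i\<in>cube M. x i = (x \<circ> wrap M) i" by (simp add: wrap_ident)
    then have "x \<circ> wrap M \<in> ?S"
      using C \<open>x \<in> C\<close> comp_wrap_periodic unfolding determined_by_def by blast
    with * show "x \<in> (\<Union>y\<in>?S. Z y)" unfolding Z_def by blast
  next
    fix x assume "x \<in> (\<Union>y\<in>?S. Z y)"
    then show "x \<in> C" using C unfolding determined_by_def Z_def by blast
  qed
  have Z: "Z y \<in> sets uniform_bernoulli" for y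
    unfolding Z_def by (rule cylinder_in_sets[OF finite_cube])
  have "(\<Union>y\<in>?S. Z y) \<in> sets uniform_bernoulli"
    using fin Z by (intro sets.finite_UN) auto
  then show "C \<in> sets uniform_bernoulli" using eq by simp
  have "disjoint_family_on Z ?S"
    unfolding disjoint_family_on_def
  proof (intro ballI impI)
    fix y z assume "y \<in> ?S" "z \<in> ?S" "y \<noteq> z"
    then show "Z y \<inter> Z z = {}"
      using periodic_configs_eqI[of y M z] by (fastforce simp: Z_def)
  qed
  then have "(\<Sum>y\<in>?S. emeasure uniform_bernoulli (Z y)) = emeasure uniform_bernoulli (\<Union>y\<in>?S. Z y)"
    using fin Z by (intro sum_emeasure) auto
  also have "(\<Union>y\<in>?S. Z y) = C" using eq by simp
  finally show "emeasure uniform_bernoulli C = of_nat (card ?S) *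
         ennreal (1 / CARD('a)) ^ card (cube M :: (int ^ 'd) set)"
    by (simp add: Z_def emeasure_cylinder[OF finite_cube])
qed

lemma determined_by_finite_in_sets:
  assumes "finite J" "determined_by J C"
  shows "C \<in> sets uniform_bernoulli"
  using assms determined_by_cube_in_sets determined_by_mono finite_subset_cube by metis

lemma cellular_automaton_measurable:
  fixes F :: "('a::finite, 'd::finite) config \<Rightarrow> ('a, 'd) config"
  assumes "cellular_automaton F"
  shows "F \<in> measurable uniform_bernoulli uniform_bernoulli"
proof -
  have "(\<lambda>x. F x m) \<in> measurable uniform_bernoulli (uniform_count_measure UNIV)" for m
  proof (rule measurableI)
    fix B :: "'a set"
    have "determined_by {m} {x :: ('a, 'd) config. x m \<in> B}" by (simp add: determined_by_def)
    then obtain J where "finite J" "determined_by J (F -` {x. x m \<in> B})"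
      using determined_by_vimage_cellular_automaton[OF assms] by blast
    then have "F -` {x. x m \<in> B} \<in> sets uniform_bernoulli"
      by (rule determined_by_finite_in_sets)
    then show "(\<lambda>x. F x m) -` B \<inter> space uniform_bernoulli \<in> sets uniform_bernoulli"
      by (simp add: vimage_def)
  qed (simp add: space_uniform_count_measure)
  then have "(\<lambda>x m. F x m) \<in> measurable uniform_bernoulli (\<Pi>\<^sub>M i\<in>UNIV. uniform_count_measure UNIV)"
    by (intro measurable_PiM_single') (auto simp: space_uniform_count_measure)
  then show ?thesis by (simp add: uniform_bernoulli_def)
qed

text \<open>Cylinder events generate the product algebra.  For such an event \<open>C\<close>, choose a cube so large that it determines
  both \<open>C\<close> and its preimage; then both measures are counted by periodic configurations of the same
  period, which \<open>F\<close> permutes.\<close>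

lemma inj_cellular_automaton_preserves_bernoulli:
  fixes F :: "('a::finite, 'd::finite) config \<Rightarrow> ('a, 'd) config"
  assumes ca: "cellular_automaton F" and "inj F"
  shows "distr uniform_bernoulli uniform_bernoulli F = uniform_bernoulli"
proof -
  let ?\<mu> = "uniform_bernoulli :: ('a, 'd) config measure"
  let ?M = "\<lambda>_ :: int ^ 'd. uniform_count_measure (UNIV :: 'a set)"
  note [measurable] = cellular_automaton_measurable[OF ca]
  have "?\<mu> = distr ?\<mu> ?\<mu> F"
  proof (rule measure_eqI_PiM_infinite)
    show "sets ?\<mu> = sets (PiM UNIV ?M)" "sets (distr ?\<mu> ?\<mu> F) = sets (PiM UNIV ?M)"
      by (simp_all add: uniform_bernoulli_def)
    show "finite_measure ?\<mu>"
      using prob_space_uniform_bernoulli by (rule prob_space.axioms(1))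
  next
    fix A :: "int ^ 'd \<Rightarrow> 'a set" and J :: "(int ^ 'd) set"
    assume J: "finite J"
    define C where "C = prod_emb UNIV ?M J (PiE J A)"
    have C: "determined_by J C"
      by (auto simp: determined_by_def C_def prod_emb_def space_uniform_count_measure PiE_iff)
    obtain J' where J': "finite J'" "determined_by J' (F -` C)"
      using determined_by_vimage_cellular_automaton[OF ca J C] by blast
    obtain N where N: "J \<union> J' \<subseteq> cube N"
      using finite_subset_cube[of "J \<union> J'"] J J'(1) by auto
    have CN: "determined_by (cube N) C" and FN: "determined_by (cube N) (F -` C)"
      using N C J'(2) determined_by_mono by (blast+)
    note perm = inj_cellular_automaton_permutes_periodic_configs[OF assms, of N]
    have "F ` (F -` C \<inter> periodic_configs N) = C \<inter> F ` periodic_configs N"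
      by blast
    also have "\<dots> = C \<inter> periodic_configs N"
      by (simp add: bij_betw_imp_surj_on[OF perm])
    finally have "F ` (F -` C \<inter> periodic_configs N) = C \<inter> periodic_configs N" .
    moreover have "inj_on F (F -` C \<inter> periodic_configs N)"
      using \<open>inj F\<close> by (rule inj_on_subset) simp
    ultimately have "card (F -` C \<inter> periodic_configs N) = card (C \<inter> periodic_configs N)"
      by (metis card_image)
    then have "emeasure ?\<mu> (F -` C) = emeasure ?\<mu> C"
      by (simp add: emeasure_determined_by_cube[OF CN] emeasure_determined_by_cube[OF FN])
    then show "emeasure ?\<mu> C = emeasure (distr ?\<mu> ?\<mu> F) C"
      by (simp add: emeasure_distr determined_by_cube_in_sets[OF CN])
  qed
  then show ?thesis by simp
qed

section \<open>Rationality of the eigenvalues\<close>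

text \<open>The exceptional null set of the eigenvalue equation changes with each iteration; invariance of the measure
  keeps its preimages null.\<close>

lemma AE_eigenfunction_funpow:
  fixes g :: "'x \<Rightarrow> complex"
  assumes meas: "F \<in> measurable M M" and inv: "distr M M F = M"
    and eig: "AE x in M. g (F x) = l * g x"
  shows "AE x in M. g ((F ^^ n) x) = l ^ n * g x"
proof (induction n)
  case (Suc n)
  have "AE x in M. g ((F ^^ n) (F x)) = l ^ n * g (F x)"
    by (rule AE_distrD[OF meas]) (subst inv, rule Suc)
  with eig show ?case
    by eventually_elim (simp add: funpow_swap1)
qed simp

lemma root_of_unity_imp_rational:
  fixes \<alpha> :: real
  assumes "p > 0" and "exp (2 * of_real pi * \<i> * of_real \<alpha>) ^ p = 1"
  shows "\<alpha> \<in> \<rat>"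
proof -
  have "exp (of_nat p * (2 * of_real pi * \<i> * of_real \<alpha>)) = 1"
    using assms(2) by (simp add: exp_of_nat_mult)
  then obtain k :: int where "real p * (2 * pi * \<alpha>) = of_int (2 * k) * pi"
    by (auto simp: exp_eq_1)
  then have "\<alpha> = of_int k / of_nat p"
    using assms(1) by (simp add: field_simps)
  then show ?thesis by simp
qed

theorem proposition16:
  fixes F :: "('a::finite, 'd::finite) config \<Rightarrow> ('a, 'd) config"
  assumes "cellular_automaton F"
    and "surj F"
    and "equicontinuous F"
  shows "\<forall>\<alpha>::real. measurable_eigenvalue F (exp (2 * of_real pi * \<i> * of_real \<alpha>)) \<longrightarrow> \<alpha> \<in> \<rat>"
proof (intro allI impI)
  fix \<alpha> :: real
  define l where "l = exp (2 * of_real pi * \<i> * of_real \<alpha>)"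
  assume "measurable_eigenvalue F (exp (2 * of_real pi * \<i> * of_real \<alpha>))"
  then obtain g where nz: "\<not> (AE x in uniform_bernoulli. g x = 0)"
    and eig: "AE x in uniform_bernoulli. g (F x) = l * g x"
    unfolding measurable_eigenvalue_def l_def by blast
  obtain p where p: "p > 0" "F ^^ p = id"
    using surj_equicontinuous_imp_periodic[OF assms] by blast
  have "inj F"
    using p by (metis inj_on_id inj_on_imageI2 funpow_Suc_right Suc_pred)
  then have "AE x in uniform_bernoulli. g ((F ^^ p) x) = l ^ p * g x"
    using assms(1) eig
    by (intro AE_eigenfunction_funpow cellular_automaton_measurable
        inj_cellular_automaton_preserves_bernoulli)
  then have "AE x in uniform_bernoulli. l ^ p = 1 \<or> g x = 0"
    by eventually_elim (auto simp: p(2))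
  with nz have "l ^ p = 1" by auto
  with p(1) show "\<alpha> \<in> \<rat>"
    unfolding l_def by (rule root_of_unity_imp_rational)
qed

end
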